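(* Let $K$ be a field, let $\mathcal{P}$ be an $L$-convex polyomino and let $\mathcal{P}^*$ be the Ferrer diagram projected by $\mathcal{P}$. Then $K[\mathcal{P}]$ and $K[\mathcal{P}^*]$ are isomorphic as standard graded $K$-algebras.
   Context: A cell is a set $C=[a,a+(1,1)]$ with $a\in\mathbb{N}^2$ its lower left corner, where $[(i,j),(k,\ell)]=\{(r,s)\in\mathbb{N}^2: i\le r\le k,\ j\le s\le \ell\}$; its vertices are $a,a+(1,0),a+(0,1),a+(1,1)$ and its edges are the four sides of the unit square. A finite collection $\mathcal{P}$ of cells is a polyomino if any two of its cells can be joined by a sequence of cells of $\mathcal{P}$ in which consecutive cells share an edge; such a sequence with distinct cells is a path. $V(\mathcal{P})$ is the set of all vertices of cells of $\mathcal{P}$. $\mathcal{P}$ is convex if whenever two cells of $\mathcal{P}$ lie in the same row (resp. column) all cells between them in that row (resp. column) belong to $\mathcal{P}$. A path $C_1,\dots,C_q$, with $(i_k,j_k)$ the lower left corner of $C_k$, has a change of direction at $C_k$ ($2\le k\le q-1$) if $i_{k-1}\ne i_{k+1}$ and $j_{k-1}\ne j_{k+1}$. A convex polyomino is $L$-convex if any two of its cells can be connected by a path of its cells with at most one change of direction. After translation the bounding box of $\mathcal{P}$ (smallest rectangle containing it) is $[(0,0),(m,n)]$; rows of cells are numbered $1,\dots,n$ from top to bottom, columns $1,\dots,m$ from left to right. The horizontal projections $H_{\mathcal{P}}=(h_1,\dots,h_n)$ and vertical projections $V_{\mathcal{P}}=(v_1,\dots,v_m)$ record the number $h_i$ of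 cells of $\mathcal{P}$ in row $i$ and the number $v_j$ of cells in column $j$. A Ferrer diagram is a polyomino such that, for all $i,j$, if the cell in row $i$ and column $j$ belongs to it, then so do all cells in row $s\le i$ and column $r\le j$ (and every row and column of the bounding box contains a cell, so the first row and the first column are full). For an $L$-convex polyomino $\mathcal{P}$, the Ferrer diagram $\mathcal{P}^*$ projected by $\mathcal{P}$ is the unique (up to translation) Ferrer diagram whose horizontal and vertical projections are the entries of $H_{\mathcal{P}}$ and of $V_{\mathcal{P}}$, respectively, rearranged in weakly decreasing order. Coordinate ring of a polyomino $\mathcal{P}$: $S=K[x_v: v\in V(\mathcal{P})]$; for $a=(i,j)$, $b=(k,\ell)$ with $i<k$, $j<\ell$ such that all cells contained in $[a,b]$ belong to $\mathcal{P}$, put $c=(i,\ell)$, $d=(k,j)$; $I_{\mathcal{P}}$ is the ideal generated by all such binomials $x_ax_b-x_cx_d$, and $K[\mathcal{P}]=S/I_{\mathcal{P}}$, standard graded with $\deg x_v=1$. *)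

theory Defs
  imports
    "HOL-Library.Poly_Mapping"
    "HOL-Algebra.Module"
    "HOL-Algebra.QuotRing"
begin

section \<open>Polyominoes\<close>

type_synonym point = "nat \<times> nat"

text \<open>A cell is represented by its lower left corner, so a collection of cells is a
  \<open>point set\<close>; \<open>cell_verts\<close> and \<open>cell_edges\<close> recover the actual unit square.\<close>

definition interval :: "point \<Rightarrow> point \<Rightarrow> point set" where
  "interval a b = {c. fst a \<le> fst c \<and> fst c \<le> fst b \<and> snd a \<le> snd c \<and> snd c \<le> snd b}"

definition cell_verts :: "point \<Rightarrow> point set" where
  "cell_verts a = interval a (fst a + 1, snd a + 1)"

definition cell_edges :: "point \<Rightarrow> point set set" where
  "cell_edges a =
     (let i = fst a; j = snd a in
       {{(i, j), (i + 1, j)}, {(i, j), (i, j + 1)},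
        {(i + 1, j), (i + 1, j + 1)}, {(i, j + 1), (i + 1, j + 1)}})"

definition share_edge :: "point \<Rightarrow> point \<Rightarrow> bool" where
  "share_edge C D \<longleftrightarrow> cell_edges C \<inter> cell_edges D \<noteq> {}"

definition cell_walk :: "point set \<Rightarrow> point \<Rightarrow> point \<Rightarrow> point list \<Rightarrow> bool" where
  "cell_walk P C D cs \<longleftrightarrow>
     cs \<noteq> [] \<and> hd cs = C \<and> last cs = D \<and> set cs \<subseteq> P \<and> successively share_edge cs"

definition cell_path :: "point set \<Rightarrow> point \<Rightarrow> point \<Rightarrow> point list \<Rightarrow> bool" where
  "cell_path P C D cs \<longleftrightarrow> cell_walk P C D cs \<and> distinct cs"

definition polyomino :: "point set \<Rightarrow> bool" where
  "polyomino P \<longleftrightarrow> finite P \<and> (\<forall>C\<in>P. \<forall>D\<in>P. \<exists>cs. cell_walk P C D cs)"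

definition poly_verts :: "point set \<Rightarrow> point set" where
  "poly_verts P = (\<Union>a\<in>P. cell_verts a)"

definition convex_polyomino :: "point set \<Rightarrow> bool" where
  "convex_polyomino P \<longleftrightarrow> polyomino P \<and>
     (\<forall>i i' j k. (i, j) \<in> P \<and> (i', j) \<in> P \<and> i \<le> k \<and> k \<le> i' \<longrightarrow> (k, j) \<in> P) \<and>
     (\<forall>i j j' k. (i, j) \<in> P \<and> (i, j') \<in> P \<and> j \<le> k \<and> k \<le> j' \<longrightarrow> (i, k) \<in> P)"

definition direction_changes :: "point list \<Rightarrow> nat set" where
  "direction_changes cs =
     {k. 1 \<le> k \<and> k + 1 < length cs \<and>
         fst (cs ! (k - 1)) \<noteq> fst (cs ! (k + 1)) \<and>
         snd (cs ! (k - 1)) \<noteq> snd (cs ! (k + 1))}"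

definition L_convex :: "point set \<Rightarrow> bool" where
  "L_convex P \<longleftrightarrow> convex_polyomino P \<and>
     (\<forall>C\<in>P. \<forall>D\<in>P. \<exists>cs. cell_path P C D cs \<and> card (direction_changes cs) \<le> 1)"

text \<open>The abscissae of the columns and the ordinates of the rows of cells of the bounding box.
  Positions in the plane are kept as they are, instead of translating the bounding box to
  the origin.\<close>

definition box_cols :: "point set \<Rightarrow> nat set" where
  "box_cols P = {i. \<exists>a\<in>P. \<exists>b\<in>P. fst a \<le> i \<and> i \<le> fst b}"

definition box_rows :: "point set \<Rightarrow> nat set" where
  "box_rows P = {j. \<exists>a\<in>P. \<exists>b\<in>P. snd a \<le> j \<and> j \<le> snd b}"

text \<open>Rows are listed from top to bottom, hence by decreasing ordinate.\<close>

definition horizontal_proj :: "point set \<Rightarrow> nat list" where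
  "horizontal_proj P =
     map (\<lambda>j. card {c \<in> P. snd c = j}) (rev (sorted_list_of_set (box_rows P)))"

definition vertical_proj :: "point set \<Rightarrow> nat list" where
  "vertical_proj P =
     map (\<lambda>i. card {c \<in> P. fst c = i}) (sorted_list_of_set (box_cols P))"

text \<open>Smaller row numbers mean larger ordinates. That each row and column of the bounding box
  contains a cell follows from connectedness.\<close>

definition ferrer_diagram :: "point set \<Rightarrow> bool" where
  "ferrer_diagram F \<longleftrightarrow> polyomino F \<and>
     (\<forall>(x, y)\<in>F. \<forall>x'\<in>box_cols F. \<forall>y'\<in>box_rows F. x' \<le> x \<and> y \<le> y' \<longrightarrow> (x', y') \<in> F)"

definition decreasing :: "nat list \<Rightarrow> nat list" where
  "decreasing xs = rev (sort xs)"

text \<open>As this diagram is determined only up to translation, it is given as a relation.\<close>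

definition projected_ferrer :: "point set \<Rightarrow> point set \<Rightarrow> bool" where
  "projected_ferrer P F \<longleftrightarrow> ferrer_diagram F \<and>
     horizontal_proj F = decreasing (horizontal_proj P) \<and>
     vertical_proj F = decreasing (vertical_proj P)"

section \<open>Graded algebras\<close>

text \<open>The scalars are the elements of a type; \<open>component A d\<close> is the homogeneous
  part of degree \<open>d\<close>.\<close>

record ('k, 'a) graded_algebra = "('k, 'a) module" +
  component :: "nat \<Rightarrow> 'a set"

definition graded_algebra_iso ::
    "('k, 'a) graded_algebra \<Rightarrow> ('k, 'b) graded_algebra \<Rightarrow> ('a \<Rightarrow> 'b) \<Rightarrow> bool" where
  "graded_algebra_iso A B \<phi> \<longleftrightarrow> \<phi> \<in> ring_iso A B \<and>
     (\<forall>c. \<forall>x\<in>carrier A. \<phi> (c \<odot>\<^bsub>A\<^esub> x) = c \<odot>\<^bsub>B\<^esub> \<phi> x) \<and>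
     (\<forall>d. \<phi> ` component A d = component B d)"

section \<open>The coordinate ring\<close>

text \<open>Monomials are finitely supported exponent functions, polynomials are finitely supported
  coefficient functions on monomials.\<close>

type_synonym 'k pt_mpoly = "(point \<Rightarrow>\<^sub>0 nat) \<Rightarrow>\<^sub>0 'k"

definition pvar :: "point \<Rightarrow> 'k::field pt_mpoly" where
  "pvar v = Poly_Mapping.single (Poly_Mapping.single v 1) 1"

definition pconst :: "'k::field \<Rightarrow> 'k pt_mpoly" where
  "pconst c = Poly_Mapping.single 0 c"

definition mpoly_ring :: "point set \<Rightarrow> 'k::field pt_mpoly ring" where
  "mpoly_ring V =
     \<lparr>carrier = {p. \<forall>m\<in>Poly_Mapping.keys p. Poly_Mapping.keys m \<subseteq> V},
      mult = (*), one = 1, zero = 0, add = (+)\<rparr>"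

definition homogeneous :: "nat \<Rightarrow> 'k::field pt_mpoly \<Rightarrow> bool" where
  "homogeneous d p \<longleftrightarrow>
     (\<forall>m\<in>Poly_Mapping.keys p. (\<Sum>v\<in>Poly_Mapping.keys m. Poly_Mapping.lookup m v) = d)"

definition inner_binomials :: "point set \<Rightarrow> 'k::field pt_mpoly set" where
  "inner_binomials P =
     {pvar (i, j) * pvar (k, l) - pvar (i, l) * pvar (k, j) | i j k l.
        i < k \<and> j < l \<and>
        (\<forall>C. cell_verts C \<subseteq> interval (i, j) (k, l) \<longrightarrow> C \<in> P)}"

definition polyomino_ideal :: "point set \<Rightarrow> 'k::field pt_mpoly set" where
  "polyomino_ideal P = Idl\<^bsub>mpoly_ring (poly_verts P)\<^esub> (inner_binomials P)"

definition coordinate_ring :: "point set \<Rightarrow> ('k::field, 'k pt_mpoly set) graded_algebra" where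
  "coordinate_ring P =
     (let S = mpoly_ring (poly_verts P); I = polyomino_ideal P; R = S Quot I in
       \<lparr>carrier = carrier R, mult = mult R, one = one R, zero = zero R, add = add R,
        smult = (\<lambda>c x. (I +>\<^bsub>S\<^esub> pconst c) \<otimes>\<^bsub>R\<^esub> x),
        component = (\<lambda>d. {I +>\<^bsub>S\<^esub> p | p. p \<in> carrier S \<and> homogeneous d p})\<rparr>)"

end

theory Submission
  imports Defs "HOL-Library.Infinite_Set"
begin

text \<open>In an \<open>L\<close>-convex polyomino any two rows of cells are comparable by inclusion, and hence so
  are any two rows of the vertex set \<open>V\<close>; the same holds for a Ferrer diagram. In both cases an
  interval is filled by cells as soon as its four corners are vertices, so the ideal is generated
  by all 2-minors whose four variables lie on \<open>V\<close>. This description is invariant under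
  permutations of the rows and of the columns of the plane. Up to such permutations a relation with
  nested rows is determined by the multisets of its row and column lengths, and those of \<open>V\<close> can be
  read off the projections: a vertex row meeting cells is longer by one than the longer of the
  two adjacent cell rows. The permutations therefore rename the variables of one ring into those of the
  other.\<close>

section \<open>Renaming variables\<close>

text \<open>The coefficient of a product is a convolution. Bijectivity of \<open>f\<close> lets both
  summation variables be written as values of \<open>f\<close>, and additivity with injectivity
  turns the constraint \<open>f k = f l + f r\<close> into \<open>k = l + r\<close>.\<close>

lemma map_key_mult:
  fixes p q :: "'a::monoid_add \<Rightarrow>\<^sub>0 'b::semiring_0"
  assumes "bij f" and add: "\<And>x y. f (x + y) = f x + f y"
  shows "Poly_Mapping.map_key f (p * q) = Poly_Mapping.map_key f p * Poly_Mapping.map_key f q"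
proof (rule poly_mapping_eqI)
  fix k
  have inj: "inj f" using assms(1) by (rule bij_is_inj)
  have eq: "f k = f l + f r \<longleftrightarrow> k = l + r" for l r
    using inj by (simp add: add[symmetric] inj_eq)
  have inner: "(\<Sum>r. Poly_Mapping.lookup q r when f k = f l + r)
      = (\<Sum>r. Poly_Mapping.lookup q (f r) when k = l + r)" for l
    by (rule Sum_any.reindex_cong[OF assms(1)]) (simp add: fun_eq_iff eq)
  have "Poly_Mapping.lookup (p * q) (f k)
      = (\<Sum>l. Poly_Mapping.lookup p (f l) * (\<Sum>r. Poly_Mapping.lookup q (f r) when k = l + r))"
    unfolding lookup_mult
    by (rule Sum_any.reindex_cong[OF assms(1)]) (simp add: fun_eq_iff inner)
  then show "Poly_Mapping.lookup (Poly_Mapping.map_key f (p * q)) k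
      = Poly_Mapping.lookup (Poly_Mapping.map_key f p * Poly_Mapping.map_key f q) k"
    by (simp add: lookup_mult map_key.rep_eq[OF inj])
qed

lemma bij_map_key:
  assumes "bij g"
  shows "bij (Poly_Mapping.map_key g :: ('b \<Rightarrow>\<^sub>0 'c::zero) \<Rightarrow> ('a \<Rightarrow>\<^sub>0 'c))"
proof (rule bijI')
  have inj: "inj g" using assms by (rule bij_is_inj)
  fix p q :: "'b \<Rightarrow>\<^sub>0 'c"
  show "Poly_Mapping.map_key g p = Poly_Mapping.map_key g q \<longleftrightarrow> p = q"
    using assms
    by (auto simp: poly_mapping_eq_iff fun_eq_iff map_key.rep_eq[OF inj]) (metis bij_pointE)
next
  have inj: "inj g" and inj': "inj (inv_into UNIV g)"
    using assms by (auto intro: bij_is_inj bij_imp_bij_inv)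
  fix q :: "'a \<Rightarrow>\<^sub>0 'c"
  show "\<exists>p. q = Poly_Mapping.map_key g p"
    by (rule exI[of _ "Poly_Mapping.map_key (inv_into UNIV g) q"])
       (simp add: map_key_compose[OF inj inj'] inj comp_def map_key_id)
qed

text \<open>For a bijection \<open>g\<close>, the inner \<open>map_key\<close> precomposes exponent
  functions with \<open>g\<close>, the outer one precomposes coefficient functions with that map.
  Two contravariant steps give a covariant one: the variable at \<open>v\<close> goes to the
  variable at \<open>g v\<close>.\<close>

definition rename :: "(point \<Rightarrow> point) \<Rightarrow> 'k::field pt_mpoly \<Rightarrow> 'k pt_mpoly" where
  "rename g = Poly_Mapping.map_key (Poly_Mapping.map_key g)"

lemma rename_inverse:
  assumes "bij g" "bij h" "\<And>x. h (g x) = x"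
  shows "rename h (rename g p) = p"
proof -
  have inj: "inj g" "inj h" using assms by (auto intro: bij_is_inj)
  have "g (h x) = x" for x using assms by (metis bij_pointE)
  then have "Poly_Mapping.map_key g \<circ> Poly_Mapping.map_key h = (\<lambda>x. x :: point \<Rightarrow>\<^sub>0 nat)"
    unfolding fun_eq_iff comp_apply map_key_compose[OF inj] using assms(3)
    by (simp add: comp_def map_key_id)
  then show ?thesis
    unfolding rename_def using assms bij_map_key
    by (subst map_key_compose) (auto intro: bij_is_inj simp: map_key_id)
qed

lemma rename_add: "bij g \<Longrightarrow> rename g (p + q) = rename g p + rename g q"
  unfolding rename_def by (intro map_key_plus bij_is_inj bij_map_key)

lemma rename_mult: "bij g \<Longrightarrow> rename g (p * q) = rename g p * rename g q"
  unfolding rename_def by (intro map_key_mult bij_map_key map_key_plus bij_is_inj)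

lemma rename_single:
  assumes "bij g"
  shows "rename g (Poly_Mapping.single (Poly_Mapping.map_key g m) c) = Poly_Mapping.single m c"
  unfolding rename_def using assms by (intro map_key_single bij_is_inj bij_map_key)

lemma rename_pvar: "bij g \<Longrightarrow> rename g (pvar v) = pvar (g v)"
  unfolding pvar_def
  using rename_single[of g "Poly_Mapping.single (g v) 1"] by (simp add: bij_is_inj)

lemma rename_pconst: "bij g \<Longrightarrow> rename g (pconst c) = pconst c"
  unfolding pconst_def using rename_single[of g 0] by (simp add: bij_is_inj)

lemma rename_minus: "bij g \<Longrightarrow> rename g (p - q) = rename g p - rename g q"
  by (metis add_diff_cancel_right' diff_add_cancel rename_add)

text \<open>A monomial \<open>m\<close> of the renamed polynomial comes from the monomial
  \<open>map_key g m\<close>. The support is needed for membership in the polynomial ring, the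
  exponent sum for the grading.\<close>

lemma keys_rename:
  assumes "bij g" "m \<in> Poly_Mapping.keys (rename g p)"
  obtains m' where "m' \<in> Poly_Mapping.keys p"
    "Poly_Mapping.keys m = g ` Poly_Mapping.keys m'"
    "(\<Sum>v\<in>Poly_Mapping.keys m. Poly_Mapping.lookup m v)
      = (\<Sum>v\<in>Poly_Mapping.keys m'. Poly_Mapping.lookup m' v)"
proof
  let ?m' = "Poly_Mapping.map_key g m"
  have inj: "inj g" using assms(1) by (rule bij_is_inj)
  show "?m' \<in> Poly_Mapping.keys p"
    using assms(2) unfolding rename_def
    by (simp add: keys_map_key bij_is_inj bij_map_key assms(1))
  show keys: "Poly_Mapping.keys m = g ` Poly_Mapping.keys ?m'"
    using assms(1) by (simp add: keys_map_key[OF inj] surj_image_vimage_eq bij_is_surj)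
  show "(\<Sum>v\<in>Poly_Mapping.keys m. Poly_Mapping.lookup m v)
      = (\<Sum>v\<in>Poly_Mapping.keys ?m'. Poly_Mapping.lookup ?m' v)"
    unfolding keys using inj by (subst sum.reindex) (auto simp: map_key.rep_eq[OF inj] inj_on_def)
qed

lemma homogeneous_rename:
  assumes "bij g" "homogeneous d p"
  shows "homogeneous d (rename g p)"
  unfolding homogeneous_def
proof
  fix m assume "m \<in> Poly_Mapping.keys (rename g p)"
  with assms(1) show "(\<Sum>v\<in>Poly_Mapping.keys m. Poly_Mapping.lookup m v) = d"
    by (rule keys_rename) (use assms(2) in \<open>simp add: homogeneous_def\<close>)
qed

lemma rename_carrier:
  assumes "bij g" "g ` V \<subseteq> W" "p \<in> carrier (mpoly_ring V)"
  shows "rename g p \<in> carrier (mpoly_ring W)"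
  unfolding mpoly_ring_def partial_object.simps mem_Collect_eq
proof
  fix m assume "m \<in> Poly_Mapping.keys (rename g p)"
  with assms(1) show "Poly_Mapping.keys m \<subseteq> W"
  proof (rule keys_rename)
    fix m' assume "m' \<in> Poly_Mapping.keys p" "Poly_Mapping.keys m = g ` Poly_Mapping.keys m'"
    then have "Poly_Mapping.keys m' \<subseteq> V" using assms(3) by (simp add: mpoly_ring_def)
    with assms(2) \<open>Poly_Mapping.keys m = g ` Poly_Mapping.keys m'\<close> show ?thesis by blast
  qed
qed

section \<open>The polynomial ring on a set of variables\<close>

lemma mpoly_ring_simps:
  "mult (mpoly_ring V) = (*)" "one (mpoly_ring V) = 1"
  "zero (mpoly_ring V) = 0" "add (mpoly_ring V) = (+)"
  by (simp_all add: mpoly_ring_def)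

lemma carrier_mpoly_ring_add:
  "p \<in> carrier (mpoly_ring V) \<Longrightarrow> q \<in> carrier (mpoly_ring V) \<Longrightarrow> p + q \<in> carrier (mpoly_ring V)"
  using keys_add[of p q] by (auto simp: mpoly_ring_def)

lemma carrier_mpoly_ring_mult:
  assumes "p \<in> carrier (mpoly_ring V)" "q \<in> carrier (mpoly_ring V)"
  shows "p * q \<in> carrier (mpoly_ring V)"
  unfolding mpoly_ring_def partial_object.simps mem_Collect_eq
proof
  fix m assume "m \<in> Poly_Mapping.keys (p * q)"
  then obtain a b where "m = a + b" "a \<in> Poly_Mapping.keys p" "b \<in> Poly_Mapping.keys q"
    using keys_mult[of p q] by blast
  moreover from this have "Poly_Mapping.keys a \<subseteq> V" "Poly_Mapping.keys b \<subseteq> V"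
    using assms by (auto simp: mpoly_ring_def simp del: split_paired_All)
  ultimately show "Poly_Mapping.keys m \<subseteq> V"
    using keys_add[of a b] by blast
qed

lemma carrier_mpoly_ring_uminus:
  "p \<in> carrier (mpoly_ring V) \<Longrightarrow> - p \<in> carrier (mpoly_ring V)"
  by (simp add: mpoly_ring_def)

lemma cring_mpoly_ring: "cring (mpoly_ring V :: 'k::field pt_mpoly ring)"
proof (rule cringI)
  show "abelian_group (mpoly_ring V :: 'k pt_mpoly ring)"
  proof (rule abelian_groupI)
    fix x :: "'k pt_mpoly"
    assume "x \<in> carrier (mpoly_ring V)"
    then show "\<exists>y\<in>carrier (mpoly_ring V). y \<oplus>\<^bsub>mpoly_ring V\<^esub> x = \<zero>\<^bsub>mpoly_ring V\<^esub>"
      by (intro bexI[of _ "- x"]) (auto simp: mpoly_ring_simps carrier_mpoly_ring_uminus)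
  qed (auto simp: mpoly_ring_simps carrier_mpoly_ring_add ac_simps, simp add: mpoly_ring_def)
  show "comm_monoid (mpoly_ring V :: 'k pt_mpoly ring)"
    by (rule comm_monoidI)
       (auto simp: mpoly_ring_simps carrier_mpoly_ring_mult ac_simps, simp add: mpoly_ring_def)
qed (simp add: mpoly_ring_simps distrib_right)

lemma rename_hom:
  assumes "bij g" "g ` V \<subseteq> W"
  shows "ring_hom_ring (mpoly_ring V) (mpoly_ring W) (rename g :: 'k::field pt_mpoly \<Rightarrow> _)"
proof (rule ring_hom_ringI)
  have "rename g (1 :: 'k pt_mpoly) = 1"
    using rename_pconst[OF assms(1), of 1] by (simp add: pconst_def)
  then show "rename g \<one>\<^bsub>mpoly_ring V\<^esub> = (\<one>\<^bsub>mpoly_ring W\<^esub> :: 'k pt_mpoly)"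
    by (simp add: mpoly_ring_simps)
qed (auto simp: mpoly_ring_simps assms rename_add rename_mult
    intro: rename_carrier[OF assms] cring.axioms cring_mpoly_ring)

section \<open>Isomorphisms of quotient algebras induced by renaming\<close>

definition quotient_algebra :: "point set \<Rightarrow> 'k::field pt_mpoly set \<Rightarrow> ('k, 'k pt_mpoly set) graded_algebra" where
  "quotient_algebra V I =
     (let S = mpoly_ring V; R = S Quot I in
       \<lparr>carrier = carrier R, mult = mult R, one = one R, zero = zero R, add = add R,
        smult = (\<lambda>c x. (I +>\<^bsub>S\<^esub> pconst c) \<otimes>\<^bsub>R\<^esub> x),
        component = (\<lambda>d. {I +>\<^bsub>S\<^esub> p | p. p \<in> carrier S \<and> homogeneous d p})\<rparr>)"

lemma coordinate_ring_eq: "coordinate_ring P = quotient_algebra (poly_verts P) (polyomino_ideal P)"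
  by (simp add: coordinate_ring_def quotient_algebra_def Let_def)

text \<open>First isomorphism theorem for the composite of \<open>rename g\<close> with the
  projection modulo \<open>J\<close>: its kernel is \<open>I\<close> by the last hypothesis, and it
  is onto because \<open>g\<close> is invertible. The induced map is linear since renaming fixes
  constants, and graded since renaming and its inverse preserve degrees.\<close>

lemma quotient_algebra_iso:
  fixes I :: "'k::field pt_mpoly set"
  assumes "bij g" "g ` V = W"
    and I: "ideal I (mpoly_ring V)" and J: "ideal J (mpoly_ring W)"
    and IJ: "\<And>p. p \<in> carrier (mpoly_ring V) \<Longrightarrow> rename g p \<in> J \<longleftrightarrow> p \<in> I"
  shows "\<exists>\<phi>. graded_algebra_iso (quotient_algebra V I) (quotient_algebra W J) \<phi>"
proof -
  define S where "S = (mpoly_ring V :: 'k pt_mpoly ring)"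
  define T where "T = (mpoly_ring W :: 'k pt_mpoly ring)"
  define h where "h p = J +>\<^bsub>T\<^esub> rename g p" for p
  interpret I: ideal I S using I by (simp add: S_def)
  interpret J: ideal J T using J by (simp add: T_def)
  interpret ren: ring_hom_ring S T "rename g"
    using assms(1,2) unfolding S_def T_def by (intro rename_hom) auto
  define g' where "g' = inv_into UNIV g"
  have g': "bij g'" "g' ` W = V" "\<And>x. g (g' x) = x"
    using assms(1,2) unfolding g'_def
    by (auto simp: bij_imp_bij_inv bij_is_inj image_comp bij_is_surj surj_f_inv_f)
  \<comment> \<open>The preimage is obtained by renaming along the inverse permutation. Keeping
    track of its degree here yields surjectivity on each graded component below.\<close>
  have surj: "\<exists>p. p \<in> carrier S \<and> q = rename g p \<and> (homogeneous d q \<longrightarrow> homogeneous d p)"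
    if "q \<in> carrier T" for q d
    using that g' assms(1) unfolding S_def T_def
    by (intro exI[of _ "rename g' q"])
       (auto simp: rename_inverse homogeneous_rename intro!: rename_carrier[of g' W])
  have "h = (+>\<^bsub>T\<^esub>) J \<circ> rename g" by (simp add: fun_eq_iff h_def)
  then have "h \<in> ring_hom S (T Quot J)"
    using ring_hom_trans[OF ren.homh J.rcos_ring_hom] by simp
  then interpret h: ring_hom_ring S "T Quot J" h
    by (intro ring_hom_ringI2 I.ring_axioms J.quotient_is_ring)
  have zero: "J +>\<^bsub>T\<^esub> q = J \<longleftrightarrow> q \<in> J" if "q \<in> carrier T" for q
    using that J.a_coset_join1 J.a_coset_join2 J.a_subgroup by blast
  have ker: "a_kernel S (T Quot J) h = I"
  proof -
    have iff: "p \<in> carrier S \<and> J +>\<^bsub>T\<^esub> rename g p = J \<longleftrightarrow> p \<in> I" for p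
    proof (cases "p \<in> carrier S")
      case True
      then show ?thesis using zero[OF ren.hom_closed[OF True]] IJ[of p] by (simp add: S_def)
    next
      case False
      then show ?thesis using I.a_subset by blast
    qed
    have "\<zero>\<^bsub>T Quot J\<^esub> = J" by (simp add: FactRing_def)
    then show ?thesis unfolding a_kernel_def' h_def set_eq_iff mem_Collect_eq using iff by (simp only:) blast
  qed
  have img: "h ` carrier S = carrier (T Quot J)"
  proof
    show "h ` carrier S \<subseteq> carrier (T Quot J)" by auto
    show "carrier (T Quot J) \<subseteq> h ` carrier S"
      unfolding FactRing_def A_RCOSETS_def' h_def using surj by fastforce
  qed
  \<comment> \<open>\<open>h\<close> is constant on each coset of its kernel, so the image of a
    coset is a singleton.\<close>
  define \<phi> where "\<phi> = (\<lambda>X. the_elem (h ` X))"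
  have iso: "\<phi> \<in> ring_iso (S Quot I) (T Quot J)"
    using h.FactRing_iso_set[OF img] by (simp add: ker \<phi>_def)
  have coset: "\<phi> (I +>\<^bsub>S\<^esub> p) = J +>\<^bsub>T\<^esub> rename g p" if "p \<in> carrier S" for p
    using h.the_elem_simp[OF that] by (simp add: \<phi>_def ker h_def)
  have const: "pconst c \<in> carrier S" for c
    by (auto simp: S_def mpoly_ring_def pconst_def)
  have "graded_algebra_iso (quotient_algebra V I) (quotient_algebra W J) \<phi>"
    unfolding graded_algebra_iso_def
  proof (intro conjI allI ballI)
    show "\<phi> \<in> ring_iso (quotient_algebra V I) (quotient_algebra W J)"
      using iso by (simp add: quotient_algebra_def S_def T_def Let_def ring_iso_def ring_hom_def)
    fix c x assume "x \<in> carrier (quotient_algebra V I)"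
    then have x: "x \<in> carrier (S Quot I)" by (simp add: quotient_algebra_def S_def Let_def)
    \<comment> \<open>Scalars act through cosets of constant polynomials, so linearity is a case of
      multiplicativity.\<close>
    have "\<phi> ((I +>\<^bsub>S\<^esub> pconst c) \<otimes>\<^bsub>S Quot I\<^esub> x)
        = (J +>\<^bsub>T\<^esub> pconst c) \<otimes>\<^bsub>T Quot J\<^esub> \<phi> x"
      using ring_hom_mult[OF _ _ x, of \<phi> "T Quot J" "I +>\<^bsub>S\<^esub> pconst c"] iso const[of c]
        ring_hom_closed[OF I.rcos_ring_hom const[of c]]
      by (simp add: coset ring_iso_def rename_pconst assms(1))
    then show "\<phi> (c \<odot>\<^bsub>quotient_algebra V I\<^esub> x) = c \<odot>\<^bsub>quotient_algebra W J\<^esub> \<phi> x"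
      by (simp add: quotient_algebra_def S_def T_def Let_def)
  next
    fix d
    have "\<phi> ` {I +>\<^bsub>S\<^esub> p | p. p \<in> carrier S \<and> homogeneous d p}
        = {J +>\<^bsub>T\<^esub> q | q. q \<in> carrier T \<and> homogeneous d q}"
    proof (intro equalityI subsetI)
      fix y assume "y \<in> \<phi> ` {I +>\<^bsub>S\<^esub> p | p. p \<in> carrier S \<and> homogeneous d p}"
      then obtain p where p: "y = J +>\<^bsub>T\<^esub> rename g p" "p \<in> carrier S" "homogeneous d p"
        using coset by auto
      from ren.hom_closed[OF p(2)] homogeneous_rename[OF assms(1) p(3)] p(1)
      show "y \<in> {J +>\<^bsub>T\<^esub> q | q. q \<in> carrier T \<and> homogeneous d q}" by blast
    next
      fix y assume "y \<in> {J +>\<^bsub>T\<^esub> q | q. q \<in> carrier T \<and> homogeneous d q}"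
      then obtain q where q: "q \<in> carrier T" "homogeneous d q" "y = J +>\<^bsub>T\<^esub> q" by blast
      obtain p where p: "p \<in> carrier S" "q = rename g p" "homogeneous d p"
        using surj[OF q(1), of d] q(2) by blast
      show "y \<in> \<phi> ` {I +>\<^bsub>S\<^esub> p | p. p \<in> carrier S \<and> homogeneous d p}"
      proof (rule image_eqI)
        show "y = \<phi> (I +>\<^bsub>S\<^esub> p)" using coset[OF p(1)] p(2) q(3) by (simp only:)
      qed (use p in blast)
    qed
    then show "\<phi> ` component (quotient_algebra V I) d = component (quotient_algebra W J) d"
      by (simp add: quotient_algebra_def S_def T_def Let_def)
  qed
  then show ?thesis by blast
qed

text \<open>It suffices to check generators in both directions: the preimage of an ideal under
  renaming is an ideal, so it contains the generated ideal once it contains the generators. The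
  inclusion for the inverse renaming supplies the converse implication in the kernel
  condition.\<close>

lemma quotient_genideal_iso:
  fixes A B :: "'k::field pt_mpoly set"
  assumes "bij g" "g ` V = W"
    and A: "A \<subseteq> carrier (mpoly_ring V)" and B: "B \<subseteq> carrier (mpoly_ring W)"
    and AB: "rename g ` A \<subseteq> Idl\<^bsub>mpoly_ring W\<^esub> B"
    and BA: "rename (inv_into UNIV g) ` B \<subseteq> Idl\<^bsub>mpoly_ring V\<^esub> A"
  shows "\<exists>\<phi>. graded_algebra_iso (quotient_algebra V (Idl\<^bsub>mpoly_ring V\<^esub> A))
    (quotient_algebra W (Idl\<^bsub>mpoly_ring W\<^esub> B)) \<phi>"
proof -
  have le: "rename f p \<in> Idl\<^bsub>mpoly_ring W'\<^esub> D"
    if "bij f" "f ` V' = W'" "C \<subseteq> carrier (mpoly_ring V')" "D \<subseteq> carrier (mpoly_ring W')"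
      "rename f ` C \<subseteq> Idl\<^bsub>mpoly_ring W'\<^esub> D" "p \<in> Idl\<^bsub>mpoly_ring V'\<^esub> C"
    for f p V' W' and C D :: "'k pt_mpoly set"
  proof -
    interpret S: cring "mpoly_ring V' :: 'k pt_mpoly ring" by (rule cring_mpoly_ring)
    interpret T: cring "mpoly_ring W' :: 'k pt_mpoly ring" by (rule cring_mpoly_ring)
    interpret ren: ring_hom_ring "mpoly_ring V'" "mpoly_ring W'" "rename f :: 'k pt_mpoly \<Rightarrow> _"
      using that(1,2) by (intro rename_hom) auto
    have "Idl\<^bsub>mpoly_ring V'\<^esub> C
        \<subseteq> {r \<in> carrier (mpoly_ring V'). rename f r \<in> Idl\<^bsub>mpoly_ring W'\<^esub> D}"
      using that by (intro S.genideal_minimal ren.ideal_vimage T.genideal_ideal) auto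
    with that(6) show ?thesis by blast
  qed
  have g': "bij (inv_into UNIV g)" "(inv_into UNIV g) ` W = V" "\<And>x. inv_into UNIV g (g x) = x"
    using assms(1,2) by (auto simp: bij_imp_bij_inv bij_is_inj image_comp)
  show ?thesis
  proof (rule quotient_algebra_iso[OF assms(1,2)])
    show "ideal (Idl\<^bsub>mpoly_ring V\<^esub> A) (mpoly_ring V)" "ideal (Idl\<^bsub>mpoly_ring W\<^esub> B) (mpoly_ring W)"
      using A B by (auto intro!: ring.genideal_ideal cring.axioms(1)[OF cring_mpoly_ring])
    show "rename g p \<in> Idl\<^bsub>mpoly_ring W\<^esub> B \<longleftrightarrow> p \<in> Idl\<^bsub>mpoly_ring V\<^esub> A" for p
      using le[OF assms(1,2) A B AB] le[OF g'(1,2) B A BA, of "rename g p"]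
        rename_inverse[OF assms(1) g'(1,3)] by metis
  qed
qed

section \<open>Nested rows\<close>

text \<open>Bijections between the level sets of \<open>f\<close> and \<open>g\<close> are chosen
  separately and glued. A positive level is a difference of two finite superlevel sets, so its size
  is determined by the given counts.\<close>

lemma level_preserving_bij:
  fixes f g :: "nat \<Rightarrow> nat"
  assumes fin: "\<And>t. 0 < t \<Longrightarrow> finite {x. t \<le> f x}" "\<And>t. 0 < t \<Longrightarrow> finite {x. t \<le> g x}"
    and card: "\<And>t. 0 < t \<Longrightarrow> card {x. t \<le> f x} = card {x. t \<le> g x}"
  obtains h where "bij h" "\<And>x. g (h x) = f x"
proof -
  have "\<exists>h. bij_betw h {x. f x = s} {x. g x = s}" for s
  proof (cases "s = 0")
    case True
    \<comment> \<open>The zero levels are cofinite in \<open>nat\<close>, so they are infinite and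
      in bijection by enumeration. This makes the permutation total, moving empty rows as
      well.\<close>
    have infinite: "infinite {x. k x = s}" if "finite {x. 1 \<le> k x}" for k :: "nat \<Rightarrow> nat"
    proof -
      have "{x. k x = s} = - {x. 1 \<le> k x}" using True by auto
      then show ?thesis using that finite_compl[of "{x. 1 \<le> k x}"] by simp
    qed
    have "infinite {x. f x = s}" "infinite {x. g x = s}"
      using fin[of 1] by (intro infinite; simp)+
    then have "bij_betw (enumerate {x. f x = s}) UNIV {x. f x = s}"
      "bij_betw (enumerate {x. g x = s}) UNIV {x. g x = s}"
      by (auto intro: bij_enumerate)
    then show ?thesis by (blast intro: bij_betw_trans bij_betw_inv_into)
  next
    case False
    have level: "{x. k x = s} = {x. s \<le> k x} - {x. Suc s \<le> k x}" for k :: "nat \<Rightarrow> nat"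
      by auto
    have "card ({x. s \<le> f x} - {x. Suc s \<le> f x}) = card ({x. s \<le> g x} - {x. Suc s \<le> g x})"
      using False fin[of "Suc s"] card[of s] card[of "Suc s"]
      by (subst (1 2) card_Diff_subset) auto
    then show ?thesis
      unfolding level using False fin[of s] by (intro finite_same_card_bij) auto
  qed
  then obtain H where H: "\<And>s. bij_betw (H s) {x. f x = s} {x. g x = s}" by metis
  define h where "h x = H (f x) x" for x
  have gh: "g (h x) = f x" for x
    using bij_betwE[OF H[of "f x"]] by (auto simp: h_def)
  have "bij h"
  proof (rule bijI')
    fix x y
    have "x = y" if "h x = h y"
    proof -
      have "f x = f y" using gh that by metis
      moreover from this have "H (f x) x = H (f x) y" using that by (simp add: h_def)
      ultimately show ?thesis using bij_betw_imp_inj_on[OF H[of "f x"]] by (simp add: inj_on_def)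
    qed
    then show "h x = h y \<longleftrightarrow> x = y" by blast
  next
    fix y
    obtain x where "f x = g y" "y = H (g y) x"
      using bij_betw_imp_surj_on[OF H[of "g y"]] by blast
    then have "y = h x" by (simp add: h_def)
    then show "\<exists>x. y = h x" ..
  qed
  with gh that show ?thesis by blast
qed

text \<open>If \<open>A\<close> holds the left ends of unit segments, this is the set of all their
  end points; it is how a row of cells determines its vertices along one axis.\<close>

definition widen :: "nat set \<Rightarrow> nat set" where
  "widen A = A \<union> Suc ` A"

lemma widen_empty [simp]: "widen {} = {}"
  by (simp add: widen_def)

lemma widen_mono: "A \<subseteq> B \<Longrightarrow> widen A \<subseteq> widen B"
  by (auto simp: widen_def)

text \<open>A nonempty finite convex set is an interval \<open>{a..b}\<close>, and widening gives
  \<open>{a..Suc b}\<close>.\<close>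

lemma card_widen:
  assumes "finite A" "A \<noteq> {}"
    and convex: "\<And>x y z. x \<in> A \<Longrightarrow> z \<in> A \<Longrightarrow> x \<le> y \<Longrightarrow> y \<le> z \<Longrightarrow> y \<in> A"
  shows "card (widen A) = Suc (card A)"
proof -
  have "A = {Min A..Max A}"
  proof (intro equalityI subsetI)
    show "y \<in> A" if "y \<in> {Min A..Max A}" for y
      using convex[OF Min_in Max_in] that assms(1,2) by simp
  qed (use assms(1) in simp)
  then obtain a b where A: "A = {a..b}" by blast
  with assms(2) have "a \<le> b" by simp
  then have "widen A = {a..Suc b}"
    unfolding widen_def A image_Suc_atLeastAtMost by auto
  then show ?thesis using A \<open>a \<le> b\<close> by simp
qed

section \<open>Nested relations and their row and column lengths\<close>

definition row :: "point set \<Rightarrow> nat \<Rightarrow> nat set" where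
  "row A j = {i. (i, j) \<in> A}"

text \<open>The rows form a chain under inclusion. Stated as the exclusion of a two by two pattern
  occupied only on one diagonal, the condition is visibly symmetric in rows and columns.\<close>

definition nested :: "point set \<Rightarrow> bool" where
  "nested A \<longleftrightarrow> (\<forall>i j k l. (i, j) \<in> A \<and> (k, l) \<in> A \<longrightarrow> (i, l) \<in> A \<or> (k, j) \<in> A)"

lemma nested_row: "nested A \<Longrightarrow> row A j \<subseteq> row A l \<or> row A l \<subseteq> row A j"
  unfolding nested_def row_def by blast

lemma finite_row: "finite A \<Longrightarrow> finite (row A j)"
  unfolding row_def by (rule finite_surj[of A _ fst]) force+

lemma finite_rows:
  assumes "finite A" "0 < t"
  shows "finite {j. t \<le> card (row A j)}"
proof (rule finite_subset)
  show "{j. t \<le> card (row A j)} \<subseteq> snd ` A"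
  proof
    fix j assume "j \<in> {j. t \<le> card (row A j)}"
    with assms(2) have "row A j \<noteq> {}" by auto
    then show "j \<in> snd ` A" by (force simp: row_def)
  qed
qed (use assms in simp)

text \<open>The elements of a column \<open>C\<close> are the indices of the \<open>card C\<close> largest rows.\<close>

lemma mem_iff_card_row:
  assumes "finite A" "nested A"
  shows "(i, j) \<in> A \<longleftrightarrow> 0 < card (row A j) \<and>
    card {l. card (row A j) \<le> card (row A l)} \<le> card (row (prod.swap ` A) i)"
proof (cases "0 < card (row A j)")
  \<comment> \<open>For an empty row, the set of rows at least as long is all of \<open>nat\<close>,
    whose \<open>card\<close> is 0, so the inequality alone would hold for every \<open>i\<close>.
    The positivity conjunct excludes this.\<close>
  case False
  then show ?thesis using finite_row[OF assms(1)] by (auto simp: row_def)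
next
  case True
  let ?L = "{l. card (row A j) \<le> card (row A l)}" and ?C = "row (prod.swap ` A) i"
  have mem: "l \<in> ?C \<longleftrightarrow> i \<in> row A l" for l by (auto simp: row_def)
  have fin: "finite ?L" "finite ?C"
    using assms(1) True by (auto intro: finite_rows finite_row)
  have sub: "row A l \<subseteq> row A l'" if "card (row A l) \<le> card (row A l')" for l l'
    using that nested_row[OF assms(2), of l l'] finite_row[OF assms(1)] card_seteq by metis
  have "(i, j) \<in> A \<Longrightarrow> card ?L \<le> card ?C"
  proof (rule card_mono)
    assume "(i, j) \<in> A"
    then show "?L \<subseteq> ?C" using sub mem by (auto simp: row_def)
  qed (rule fin)
  moreover have "(i, j) \<notin> A \<Longrightarrow> card ?C < card ?L"
  proof (rule psubset_card_mono)
    assume "(i, j) \<notin> A"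
    then have "i \<notin> row A j" by (simp add: row_def)
    \<comment> \<open>A row containing \<open>i\<close> cannot lie inside row \<open>j\<close>, so
      by nestedness it is at least as long; row \<open>j\<close> itself is in \<open>?L\<close> but
      not in \<open>?C\<close>, which makes the inclusion strict.\<close>
    then have "?C \<subseteq> ?L" "j \<notin> ?C" using sub mem by (auto simp: subset_iff) (meson nat_le_linear)
    then show "?C \<subset> ?L" by blast
  qed (rule fin)
  ultimately show ?thesis using True by fastforce
qed

section \<open>From rows of cells to rows of vertices\<close>

definition rc_convex :: "point set \<Rightarrow> bool" where
  "rc_convex P \<longleftrightarrow>
     (\<forall>i i' j k. (i, j) \<in> P \<and> (i', j) \<in> P \<and> i \<le> k \<and> k \<le> i' \<longrightarrow> (k, j) \<in> P) \<and>
     (\<forall>i j j' k. (i, j) \<in> P \<and> (i, j') \<in> P \<and> j \<le> k \<and> k \<le> j' \<longrightarrow> (i, k) \<in> P)"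

text \<open>The properties shared by \<open>L\<close>-convex polyominoes and Ferrer diagrams on
  which the comparison of the rings rests; they are invariant under exchanging rows and
  columns.\<close>

definition nested_cells :: "point set \<Rightarrow> bool" where
  "nested_cells P \<longleftrightarrow> finite P \<and> rc_convex P \<and> nested P"

lemma mem_swap_image [simp]: "(i, j) \<in> prod.swap ` A \<longleftrightarrow> (j, i) \<in> A"
  by force

lemma nested_cells_swap: "nested_cells P \<Longrightarrow> nested_cells (prod.swap ` P)"
  unfolding nested_cells_def rc_convex_def nested_def mem_swap_image by blast

lemma finite_interval: "finite (interval a b)"
proof (rule finite_subset)
  show "interval a b \<subseteq> {fst a..fst b} \<times> {snd a..snd b}" by (auto simp: interval_def)
qed simp

lemma finite_poly_verts: "finite P \<Longrightarrow> finite (poly_verts P)"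
  by (auto simp: poly_verts_def cell_verts_def intro: finite_interval)

lemma mem_poly_verts:
  "(i, j) \<in> poly_verts P \<longleftrightarrow> (\<exists>p q. (p, q) \<in> P \<and> (i = p \<or> i = Suc p) \<and> (j = q \<or> j = Suc q))"
proof -
  have "p \<le> x \<and> x \<le> Suc p \<longleftrightarrow> x = p \<or> x = Suc p" for p x :: nat by auto
  moreover have "(i, j) \<in> poly_verts P
      \<longleftrightarrow> (\<exists>p q. (p, q) \<in> P \<and> (p \<le> i \<and> i \<le> Suc p) \<and> (q \<le> j \<and> j \<le> Suc q))"
    by (simp add: poly_verts_def cell_verts_def interval_def Bex_def)
  ultimately show ?thesis by simp
qed

lemma poly_verts_swap: "poly_verts (prod.swap ` P) = prod.swap ` poly_verts P"
  unfolding set_eq_iff split_paired_All mem_swap_image mem_poly_verts by blast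

text \<open>Vertex row \<open>j\<close> borders cell rows \<open>j - 1\<close> and \<open>j\<close>.
  One of them contains the other, and the larger one alone determines the vertices.\<close>

lemma row_poly_verts:
  assumes "nested P"
  obtains q where "j = q \<or> j = Suc q" "row (poly_verts P) j = widen (row P q)"
    "\<And>q'. j = q' \<or> j = Suc q' \<Longrightarrow> row P q' \<subseteq> row P q"
proof -
  have "\<exists>q. (j = q \<or> j = Suc q) \<and> (\<forall>q'. j = q' \<or> j = Suc q' \<longrightarrow> row P q' \<subseteq> row P q)"
    \<comment> \<open>For \<open>j = 0\<close> the alternative \<open>j = Suc q\<close> is
      impossible and only cell row 0 is adjacent.\<close>
    using nested_row[OF assms, of "j - 1" j] by (cases j) auto
  then obtain q where q: "j = q \<or> j = Suc q"
    "\<And>q'. j = q' \<or> j = Suc q' \<Longrightarrow> row P q' \<subseteq> row P q" by blast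
  moreover have "row (poly_verts P) j = widen (row P q)"
  proof -
    have "row (poly_verts P) j
        = {i. \<exists>p q'. p \<in> row P q' \<and> (i = p \<or> i = Suc p) \<and> (j = q' \<or> j = Suc q')}"
      by (simp add: row_def mem_poly_verts)
    also have "\<dots> = {i. \<exists>p\<in>row P q. i = p \<or> i = Suc p}" using q by blast
    also have "\<dots> = widen (row P q)" unfolding widen_def by blast
    finally show ?thesis .
  qed
  ultimately show ?thesis using that by blast
qed

lemma row_convex:
  "rc_convex P \<Longrightarrow> x \<in> row P j \<Longrightarrow> z \<in> row P j \<Longrightarrow> x \<le> y \<Longrightarrow> y \<le> z \<Longrightarrow> y \<in> row P j"
  unfolding rc_convex_def row_def by blast

lemma column_convex:
  "rc_convex P \<Longrightarrow> x \<in> row P j \<Longrightarrow> x \<in> row P l \<Longrightarrow> j \<le> k \<Longrightarrow> k \<le> l \<Longrightarrow> x \<in> row P k"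
  unfolding rc_convex_def row_def by blast

lemma nested_poly_verts:
  assumes "nested P"
  shows "nested (poly_verts P)"
proof -
  have "row (poly_verts P) j \<subseteq> row (poly_verts P) l \<or> row (poly_verts P) l \<subseteq> row (poly_verts P) j" for j l
  proof -
    obtain q q' where "row (poly_verts P) j = widen (row P q)" "row (poly_verts P) l = widen (row P q')"
      using row_poly_verts[OF assms] by metis
    then show ?thesis using nested_row[OF assms, of q q'] by (metis widen_mono)
  qed
  then show ?thesis unfolding nested_def row_def by blast
qed

text \<open>A vertex row is one longer than the larger adjacent cell row, whence the threshold
  \<open>t - 1\<close>. The maximum with 1 handles \<open>t = 1\<close>: an empty cell row widens to
  an empty set. Adjacency means \<open>j = q\<close> or \<open>j = Suc q\<close>, which is a
  widening in the vertical direction.\<close>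

lemma rows_poly_verts:
  assumes "nested_cells P" "0 < t"
  shows "{j. t \<le> card (row (poly_verts P) j)} = widen {q. max 1 (t - 1) \<le> card (row P q)}"
proof -
  have P: "nested P" "rc_convex P" "finite P" using assms(1) by (auto simp: nested_cells_def)
  have "t \<le> card (row (poly_verts P) j)
      \<longleftrightarrow> (\<exists>q. (j = q \<or> j = Suc q) \<and> max 1 (t - 1) \<le> card (row P q))" for j
  proof -
    obtain q where q: "j = q \<or> j = Suc q" "row (poly_verts P) j = widen (row P q)"
      "\<And>q'. j = q' \<or> j = Suc q' \<Longrightarrow> row P q' \<subseteq> row P q" 
      by (rule row_poly_verts[OF P(1), of j]) (rule that; assumption)
    have "(\<exists>q. (j = q \<or> j = Suc q) \<and> max 1 (t - 1) \<le> card (row P q))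
        \<longleftrightarrow> max 1 (t - 1) \<le> card (row P q)"
      (is "?l \<longleftrightarrow> ?r")
    proof
      assume ?l
      then obtain q' where "j = q' \<or> j = Suc q'" "max 1 (t - 1) \<le> card (row P q')" by blast
      then show ?r using card_mono[OF finite_row[OF P(3)] q(3)] le_trans by blast
    next
      show ?l if ?r using that q(1) by blast
    qed
    moreover have "t \<le> card (widen (row P q)) \<longleftrightarrow> max 1 (t - 1) \<le> card (row P q)"
    proof (cases "row P q = {}")
      case False
      have "card (widen (row P q)) = Suc (card (row P q))"
        by (intro card_widen finite_row P False) (rule row_convex[OF P(2)])
      moreover have "card (row P q) > 0" using False finite_row[OF P(3)] by (simp add: card_gt_0_iff)
      ultimately show ?thesis by auto
    qed (use assms(2) in simp)
    ultimately show ?thesis using q(2) by simp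
  qed
  then show ?thesis unfolding widen_def by blast
qed

lemma card_rows_poly_verts:
  assumes "nested_cells P" "0 < t"
  shows "card {j. t \<le> card (row (poly_verts P) j)}
    = (let n = card {q. max 1 (t - 1) \<le> card (row P q)} in if n = 0 then 0 else Suc n)"
proof -
  have P: "nested P" "rc_convex P" "finite P" using assms(1) by (auto simp: nested_cells_def)
  let ?s = "max 1 (t - 1)" let ?T = "{q. ?s \<le> card (row P q)}"
  have fin: "finite ?T" using P(3) by (intro finite_rows) auto
  \<comment> \<open>The indices of long rows form an interval: column convexity puts the
    intersection of rows \<open>j\<close> and \<open>l\<close> into row \<open>k\<close>, and by
    nestedness this intersection is one of the two rows. Hence \<open>card_widen\<close> applies
    vertically too.\<close>
  have convex: "k \<in> ?T" if jl: "j \<in> ?T" "l \<in> ?T" "j \<le> k" "k \<le> l" for j k l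
  proof -
    have "row P j \<inter> row P l \<subseteq> row P k" using column_convex[OF P(2)] jl by blast
    then have "row P j \<subseteq> row P k \<or> row P l \<subseteq> row P k" using nested_row[OF P(1), of j l] by blast
    then have "card (row P j) \<le> card (row P k) \<or> card (row P l) \<le> card (row P k)"
      using card_mono[OF finite_row[OF P(3)]] by blast
    then show ?thesis using jl(1,2) by auto
  qed
  show ?thesis
  proof (cases "?T = {}")
    case True
    then show ?thesis unfolding rows_poly_verts[OF assms] True by simp
  next
    case False
    have "card (widen ?T) = Suc (card ?T)"
      by (rule card_widen[OF fin False]) (rule convex; assumption)
    then show ?thesis unfolding rows_poly_verts[OF assms] using False fin by (simp add: Let_def)
  qed
qed

section \<open>Row lengths and projections\<close>

lemma card_filter_row: "card {c \<in> P. snd c = j} = card (row P j)"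
  by (rule bij_betw_same_card[of fst])
     (auto simp: bij_betw_def inj_on_def row_def image_iff)

lemma finite_box_rows: "finite P \<Longrightarrow> finite (box_rows P)"
  unfolding box_rows_def
  by (rule finite_subset[of _ "\<Union>a\<in>P. \<Union>b\<in>P. {snd a..snd b}"]) fastforce+

text \<open>Counts above a threshold do not see the order of the list, so they can be compared after
  sorting. Positivity of \<open>t\<close> confines the counted rows to the bounding box.\<close>

lemma card_rows_horizontal_proj:
  assumes "finite P" "0 < t"
  shows "card {q. t \<le> card (row P q)} = length (filter ((\<le>) t) (horizontal_proj P))"
proof -
  have "j \<in> box_rows P" if "t \<le> card (row P j)" for j
  proof -
    have "row P j \<noteq> {}" using that assms(2) by auto
    then show ?thesis by (force simp: row_def box_rows_def)
  qed
  then have "{q. t \<le> card (row P q)} = {q \<in> box_rows P. t \<le> card (row P q)}" by blast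
  then have "{q. t \<le> card (row P q)}
      = set (filter (\<lambda>j. t \<le> card (row P j)) (rev (sorted_list_of_set (box_rows P))))"
    using finite_box_rows[OF assms(1)] by auto
  then have "card {q. t \<le> card (row P q)}
      = length (filter (\<lambda>j. t \<le> card (row P j)) (rev (sorted_list_of_set (box_rows P))))"
    by (simp only: distinct_card distinct_filter distinct_rev distinct_sorted_list_of_set)
  also have "\<dots> = length (filter ((\<le>) t) (horizontal_proj P))"
    by (simp add: horizontal_proj_def card_filter_row filter_map comp_def)
  finally show ?thesis .
qed

section \<open>Polyominoes with nested rows\<close>

lemma cell_edge_projections:
  assumes "e \<in> cell_edges C"
  shows "fst ` e = {fst C, Suc (fst C)} \<and> is_singleton (snd ` e) \<or>
    snd ` e = {snd C, Suc (snd C)} \<and> is_singleton (fst ` e)"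
  using assms unfolding cell_edges_def Let_def
  by (elim insertE emptyE) (simp_all add: is_singleton_def)

text \<open>The common edge projects to a pair of consecutive numbers on exactly one axis, and that
  pair determines the coordinate of either cell on this axis.\<close>

lemma share_edge_aligned:
  assumes "share_edge C D"
  shows "fst C = fst D \<or> snd C = snd D"
proof -
  have not_singleton: "\<not> is_singleton {x, Suc x}" for x
    by (auto simp: is_singleton_def doubleton_eq_iff)
  have eq: "x = y" if "{x, Suc x} = {y, Suc y}" for x y
    using that by (auto simp: doubleton_eq_iff)
  obtain e where "e \<in> cell_edges C" "e \<in> cell_edges D"
    using assms by (auto simp: share_edge_def)
  from this[THEN cell_edge_projections] show ?thesis
    using not_singleton eq by metis
qed

lemma straight_segment:
  assumes path: "successively share_edge cs" "distinct cs"
    and "a \<le> b" "b < length cs" "\<And>k. a < k \<Longrightarrow> k < b \<Longrightarrow> k \<notin> direction_changes cs"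
  shows "(\<forall>k\<in>{a..b}. fst (cs ! k) = fst (cs ! a)) \<or> (\<forall>k\<in>{a..b}. snd (cs ! k) = snd (cs ! a))"
  using assms(3-5)
proof (induction b rule: dec_induct)
  case base
  then show ?case by simp
next
  case (step n)
  have aligned: "fst (cs ! k) = fst (cs ! Suc k) \<or> snd (cs ! k) = snd (cs ! Suc k)"
    if "Suc k < length cs" for k
    using path(1) that share_edge_aligned by (auto simp: successively_conv_nth)
  have IH: "(\<forall>k\<in>{a..n}. fst (cs ! k) = fst (cs ! a)) \<or> (\<forall>k\<in>{a..n}. snd (cs ! k) = snd (cs ! a))"
    using step by simp
  have ext: "{a..Suc n} = insert (Suc n) {a..n}" using step.hyps by auto
  show ?case
  proof (cases "n = a")
    case True
    then show ?thesis using aligned[of n] step.prems ext by auto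
  next
    case False
    have n: "n \<in> {a..n}" "n - 1 \<in> {a..n}" "Suc (n - 1) = n" "Suc n < length cs"
      using False step by auto
    have "n \<notin> direction_changes cs" using step False by auto
    then have straight: "fst (cs ! (n - 1)) = fst (cs ! Suc n) \<or> snd (cs ! (n - 1)) = snd (cs ! Suc n)"
      using n by (auto simp: direction_changes_def)
    \<comment> \<open>Say the first coordinate has been constant. Distinctness makes the second
      coordinates at \<open>n - 1\<close> and \<open>n\<close> differ; so if the second coordinate
      at \<open>Suc n\<close> equals the one at \<open>n - 1\<close>, alignment of the last step
      still preserves the first coordinate.\<close>
    have "cs ! (n - 1) \<noteq> cs ! n"
      using path(2) n by (simp add: nth_eq_iff_index_eq)
    then have "fst (cs ! (n - 1)) \<noteq> fst (cs ! n) \<or> snd (cs ! (n - 1)) \<noteq> snd (cs ! n)"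
      by (simp add: prod_eq_iff)
    then show ?thesis
      using IH straight aligned[OF n(4)] n(1,2) unfolding ext by (metis insert_iff)
  qed
qed

text \<open>A path with at most one turn consists of two straight segments meeting at a cell
  \<open>cs ! m\<close>. This cell shares a coordinate with each end, so it is one of the two
  missing corners, or the ends share a row or column and the claim is trivial.\<close>

lemma L_convex_nested_cells:
  assumes "L_convex P"
  shows "nested_cells P"
proof -
  have "(i, l) \<in> P \<or> (k, j) \<in> P" if mem: "(i, j) \<in> P" "(k, l) \<in> P" for i j k l
  proof -
    obtain cs where cs: "cell_path P (i, j) (k, l) cs" "card (direction_changes cs) \<le> 1"
      using assms mem unfolding L_convex_def by blast
    then have path: "successively share_edge cs" "distinct cs" "set cs \<subseteq> P" "cs \<noteq> []"
      and ends: "cs ! 0 = (i, j)" "cs ! (length cs - 1) = (k, l)"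
      by (auto simp: cell_path_def cell_walk_def hd_conv_nth last_conv_nth)
    have dc: "direction_changes cs \<subseteq> {..<length cs}" by (auto simp: direction_changes_def)
    then have "finite (direction_changes cs)" by (rule finite_subset) simp
    then have "direction_changes cs = {} \<or> (\<exists>m. direction_changes cs = {m})"
      using cs(2) by (metis card_0_eq card_1_singletonE le_neq_implies_less less_one)
    \<comment> \<open>If the path never turns, any index may serve as \<open>m\<close>.\<close>
    then obtain m where m: "m < length cs" "direction_changes cs \<subseteq> {m}"
      using dc path(4) by (metis empty_subsetI insert_subset length_greater_0_conv lessThan_iff order_refl)
    have "fst (cs ! m) = i \<or> snd (cs ! m) = j"
    proof -
      have "(\<forall>k\<in>{0..m}. fst (cs ! k) = fst (cs ! 0)) \<or> (\<forall>k\<in>{0..m}. snd (cs ! k) = snd (cs ! 0))"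
        using m by (intro straight_segment path) auto
      then show ?thesis using ends(1) by auto
    qed
    moreover have "fst (cs ! m) = k \<or> snd (cs ! m) = l"
    proof -
      let ?n = "length cs - 1"
      have "(\<forall>k\<in>{m..?n}. fst (cs ! k) = fst (cs ! m)) \<or> (\<forall>k\<in>{m..?n}. snd (cs ! k) = snd (cs ! m))"
        using m by (intro straight_segment path) auto
      then show ?thesis using ends(2) m by (metis Suc_pred' atLeastAtMost_iff fst_conv snd_conv
          length_greater_0_conv less_Suc_eq_le order_refl path(4))
    qed
    moreover have "cs ! m \<in> P" using m(1) path(3) by auto
    ultimately show ?thesis using mem by (cases "cs ! m") auto
  qed
  then have "nested P" unfolding nested_def by blast
  moreover have "convex_polyomino P" using assms unfolding L_convex_def by (rule conjunct1)
  then have "polyomino P" "rc_convex P"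
    unfolding convex_polyomino_def rc_convex_def by (rule conjunct1, rule conjunct2)
  moreover from this(1) have "finite P" unfolding polyomino_def by (rule conjunct1)
  ultimately show ?thesis by (simp add: nested_cells_def)
qed

text \<open>A Ferrer diagram is closed under moving left and up within its box. Of two cells, the
  one farther right can be moved along its row to the column of the other, which gives
  nestedness.\<close>

lemma ferrer_diagram_nested_cells:
  assumes "ferrer_diagram F"
  shows "nested_cells F"
proof -
  have corner: "(x', y') \<in> F"
    if "(x, y) \<in> F" "(x', v) \<in> F" "(u, y') \<in> F" "x' \<le> x" "y \<le> y'" for x y x' y' u v
  proof -
    have "x' \<in> box_cols F" "y' \<in> box_rows F"
      using that(2,3) by (force simp: box_cols_def box_rows_def)+
    then show ?thesis using assms that unfolding ferrer_diagram_def by blast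
  qed
  have "nested F"
    unfolding nested_def using corner by (metis nat_le_linear order_refl)
  moreover have "rc_convex F"
    unfolding rc_convex_def
  proof (intro conjI allI impI; elim conjE)
    fix i i' j k assume *: "(i, j) \<in> F" "(i', j) \<in> F" "i \<le> k" "k \<le> i'"
    then have "k \<in> box_cols F" "j \<in> box_rows F"
      by (force simp: box_cols_def box_rows_def)+
    then show "(k, j) \<in> F" using assms * unfolding ferrer_diagram_def by blast
  next
    fix i j j' k assume *: "(i, j) \<in> F" "(i, j') \<in> F" "j \<le> k" "k \<le> j'"
    then have "i \<in> box_cols F" "k \<in> box_rows F"
      by (force simp: box_cols_def box_rows_def)+
    then show "(i, k) \<in> F" using assms * unfolding ferrer_diagram_def by blast
  qed
  moreover have "finite F" using assms by (simp add: ferrer_diagram_def polyomino_def)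
  ultimately show ?thesis by (simp add: nested_cells_def)
qed

section \<open>Inner intervals and 2-minors\<close>

lemma cell_verts_subset_interval:
  "cell_verts (p, q) \<subseteq> interval (i, j) (k, l) \<longleftrightarrow> i \<le> p \<and> p < k \<and> j \<le> q \<and> q < l"
proof
  assume "cell_verts (p, q) \<subseteq> interval (i, j) (k, l)"
  moreover have "(p, q) \<in> cell_verts (p, q)" "(Suc p, Suc q) \<in> cell_verts (p, q)"
    by (auto simp: cell_verts_def interval_def)
  ultimately have "(p, q) \<in> interval (i, j) (k, l)" "(Suc p, Suc q) \<in> interval (i, j) (k, l)"
    by blast+
  then show "i \<le> p \<and> p < k \<and> j \<le> q \<and> q < l" by (simp add: interval_def)
qed (auto simp: cell_verts_def interval_def)

definition corners_in :: "point set \<Rightarrow> nat \<Rightarrow> nat \<Rightarrow> nat \<Rightarrow> nat \<Rightarrow> bool" where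
  "corners_in V i j k l \<longleftrightarrow> (i, j) \<in> V \<and> (k, l) \<in> V \<and> (i, l) \<in> V \<and> (k, j) \<in> V"

lemma inner_interval_iff_corners:
  assumes "nested_cells P" "i < k" "j < l"
  shows "(\<forall>C. cell_verts C \<subseteq> interval (i, j) (k, l) \<longrightarrow> C \<in> P)
    \<longleftrightarrow> corners_in (poly_verts P) i j k l"
proof
  assume inner: "\<forall>C. cell_verts C \<subseteq> interval (i, j) (k, l) \<longrightarrow> C \<in> P"
  have cell: "(p, q) \<in> P" if "i \<le> p" "p < k" "j \<le> q" "q < l" for p q
    using inner that cell_verts_subset_interval by blast
  have "(i, j) \<in> P" "(k - 1, j) \<in> P" "(i, l - 1) \<in> P" "(k - 1, l - 1) \<in> P"
    using assms(2,3) by (auto intro!: cell)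
  moreover have "k = Suc (k - 1)" "l = Suc (l - 1)" using assms(2,3) by auto
  ultimately show "corners_in (poly_verts P) i j k l"
    unfolding corners_in_def mem_poly_verts by blast
next
  assume corners: "corners_in (poly_verts P) i j k l"
  have P: "nested P" "rc_convex P" using assms(1) by (auto simp: nested_cells_def)
  \<comment> \<open>Both corners on a horizontal side come from the same adjacent cell row, because
    a whole vertex row is the widening of a single cell row. Row convexity then fills the
    side.\<close>
  have cell: "\<exists>y'. (y = y' \<or> y = Suc y') \<and> x \<in> row P y'"
    if "(i, y) \<in> poly_verts P" "(k, y) \<in> poly_verts P" "i \<le> x" "x < k" for x y
  proof -
    obtain y' where y': "y = y' \<or> y = Suc y'" "row (poly_verts P) y = widen (row P y')"
      using row_poly_verts[OF P(1)] by metis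
    then have "i \<in> widen (row P y')" "k \<in> widen (row P y')"
      using that by (auto simp: row_def)
    then obtain u v where "u \<in> row P y'" "v \<in> row P y'" "u \<le> i" "k \<le> Suc v"
      unfolding widen_def by fastforce
    then have "x \<in> row P y'" using row_convex[OF P(2), of u y' v x] that(3,4) by simp
    with y'(1) show ?thesis by blast
  qed
  show "\<forall>C. cell_verts C \<subseteq> interval (i, j) (k, l) \<longrightarrow> C \<in> P"
  proof (intro allI impI)
    fix C assume "cell_verts C \<subseteq> interval (i, j) (k, l)"
    then obtain p q where C: "C = (p, q)" "i \<le> p" "p < k" "j \<le> q" "q < l"
      using cell_verts_subset_interval by (metis surj_pair)
    obtain j' l' where "j = j' \<or> j = Suc j'" "p \<in> row P j'" "l = l' \<or> l = Suc l'" "p \<in> row P l'"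
      using cell[of j p] cell[of l p] corners C unfolding corners_in_def by blast
    \<comment> \<open>The cell rows \<open>j'\<close> and \<open>l'\<close> may lie just outside the
      interval, but in all cases \<open>j' \<le> q\<close> and \<open>q \<le> l'\<close>.\<close>
    then have "p \<in> row P q" using C by (intro column_convex[OF P(2), of p j' l' q]) auto
    then show "C \<in> P" using C(1) by (simp add: row_def)
  qed
qed

definition minor :: "nat \<Rightarrow> nat \<Rightarrow> nat \<Rightarrow> nat \<Rightarrow> 'k::field pt_mpoly" where
  "minor i j k l = pvar (i, j) * pvar (k, l) - pvar (i, l) * pvar (k, j)"

lemma inner_binomials_eq:
  assumes "nested_cells P"
  shows "inner_binomials P = {minor i j k l | i j k l. i < k \<and> j < l \<and> corners_in (poly_verts P) i j k l}"
proof -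
  have "i < k \<and> j < l \<and> (\<forall>C. cell_verts C \<subseteq> interval (i, j) (k, l) \<longrightarrow> C \<in> P)
      \<longleftrightarrow> i < k \<and> j < l \<and> corners_in (poly_verts P) i j k l" for i j k l
    using inner_interval_iff_corners[OF assms] by blast
  then show ?thesis unfolding inner_binomials_def minor_def by simp
qed

lemma pvar_carrier: "v \<in> V \<Longrightarrow> pvar v \<in> carrier (mpoly_ring V)"
  by (simp add: mpoly_ring_def pvar_def)

lemma minor_carrier: "corners_in V i j k l \<Longrightarrow> minor i j k l \<in> carrier (mpoly_ring V)"
  unfolding minor_def corners_in_def diff_conv_add_uminus
  by (intro carrier_mpoly_ring_add carrier_mpoly_ring_uminus carrier_mpoly_ring_mult pvar_carrier) auto

lemma inner_binomials_carrier:
  "nested_cells P \<Longrightarrow> inner_binomials P \<subseteq> carrier (mpoly_ring (poly_verts P))"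
  by (auto simp: inner_binomials_eq intro: minor_carrier)

text \<open>Exchanging two rows or two columns only changes the sign of a 2-minor. Dropping the
  order of the indices prepares for permutations, which need not respect it.\<close>

lemma minor_mem_polyomino_ideal:
  assumes "nested_cells P" "corners_in (poly_verts P) i j k l" "i \<noteq> k" "j \<noteq> l"
  shows "(minor i j k l :: 'k::field pt_mpoly) \<in> polyomino_ideal P"
proof -
  let ?S = "mpoly_ring (poly_verts P) :: 'k pt_mpoly ring"
  interpret S: cring ?S by (rule cring_mpoly_ring)
  interpret I: ideal "polyomino_ideal P" ?S
    unfolding polyomino_ideal_def by (intro S.genideal_ideal inner_binomials_carrier assms(1))
  have "- 1 \<in> carrier ?S" using carrier_mpoly_ring_uminus[OF S.one_closed] by (simp add: mpoly_ring_simps)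
  then have neg: "- p \<in> polyomino_ideal P" if "p \<in> polyomino_ideal P" for p :: "'k pt_mpoly"
    using I.I_l_closed[OF that, of "- 1"] by (simp add: mpoly_ring_simps)
  have gen: "minor i j k l \<in> (polyomino_ideal P :: 'k pt_mpoly set)"
    if "corners_in (poly_verts P) i j k l" "i < k" "j < l" for i j k l
    using S.genideal_self[OF inner_binomials_carrier[OF assms(1)]] inner_binomials_eq[OF assms(1)] that
    unfolding polyomino_ideal_def by blast
  have corners: "corners_in (poly_verts P) k j i l" "corners_in (poly_verts P) i l k j"
    "corners_in (poly_verts P) k l i j"
    using assms(2) by (auto simp: corners_in_def)
  have minors: "minor i j k l = - (minor k j i l :: 'k pt_mpoly)"
    "minor i j k l = - (minor i l k j :: 'k pt_mpoly)" "minor i j k l = (minor k l i j :: 'k pt_mpoly)"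
    by (simp_all add: minor_def mult.commute)
  consider "i < k" "j < l" | "k < i" "j < l" | "i < k" "l < j" | "k < i" "l < j"
    using assms(3,4) by linarith
  then show ?thesis
  proof cases
    case 1 then show ?thesis using gen assms(2) by blast
  next
    case 2 then show ?thesis using neg[OF gen[OF corners(1)]] minors(1) by simp
  next
    case 3 then show ?thesis using neg[OF gen[OF corners(2)]] minors(2) by simp
  next
    case 4 then show ?thesis using gen[OF corners(3)] minors(3) by simp
  qed
qed

section \<open>Transport of the ideal along row and column permutations\<close>

lemma rename_inner_binomials:
  assumes "nested_cells P" "nested_cells Q" "bij s" "bij t"
    and "\<And>i j. (i, j) \<in> poly_verts P \<longleftrightarrow> (s i, t j) \<in> poly_verts Q"
  shows "rename (map_prod s t) ` inner_binomials P \<subseteq> (polyomino_ideal Q :: 'k::field pt_mpoly set)"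
proof -
  have bij: "bij (map_prod s t)"
    using assms(3,4) by (simp add: bij_def map_prod_inj_on prod.inj_map map_prod_surj)
  have "rename (map_prod s t) (minor i j k l) \<in> (polyomino_ideal Q :: 'k pt_mpoly set)"
    if "i < k" "j < l" "corners_in (poly_verts P) i j k l" for i j k l
  proof -
    have "rename (map_prod s t) (minor i j k l) = (minor (s i) (t j) (s k) (t l) :: 'k pt_mpoly)"
      by (simp add: minor_def rename_minus rename_mult rename_pvar bij)
    moreover have "s i \<noteq> s k" "t j \<noteq> t l"
      using that(1,2) assms(3,4) by (auto simp: bij_def inj_eq)
    moreover have "corners_in (poly_verts Q) (s i) (t j) (s k) (t l)"
      using that(3) assms(5) by (simp add: corners_in_def)
    ultimately show ?thesis using minor_mem_polyomino_ideal[OF assms(2)] by simp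
  qed
  then show ?thesis by (auto simp: inner_binomials_eq[OF assms(1)])
qed

lemma coordinate_ring_iso_of_permutation:
  assumes "nested_cells P" "nested_cells Q" "bij s" "bij t"
    and eq: "\<And>i j. (i, j) \<in> poly_verts P \<longleftrightarrow> (s i, t j) \<in> poly_verts Q"
  shows "\<exists>\<phi>. graded_algebra_iso
           (coordinate_ring P :: ('k::field, 'k pt_mpoly set) graded_algebra)
           (coordinate_ring Q :: ('k, 'k pt_mpoly set) graded_algebra) \<phi>"
proof -
  let ?g = "map_prod s t" and ?s = "inv_into UNIV s" and ?t = "inv_into UNIV t"
  have bij: "bij ?g" "bij ?s" "bij ?t"
    using assms(3,4) by (simp_all add: bij_def prod.inj_map map_prod_surj inj_imp_surj_inv surj_imp_inj_inv)
  have inverse: "?s (s i) = i" "s (?s i) = i" "?t (t i) = i" "t (?t i) = i" for i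
    using assms(3,4) by (simp_all add: bij_is_inj bij_is_surj surj_f_inv_f)
  have inv_g: "inv_into UNIV ?g = map_prod ?s ?t"
  \<comment> \<open>The inverse of the product map is the product of the inverses, so the backward
    inclusion of generators is the forward one with \<open>P\<close> and \<open>Q\<close>
    exchanged.\<close>
  proof
    fix x :: point
    show "inv_into UNIV ?g x = map_prod ?s ?t x"
      by (rule inv_f_eq[OF bij_is_inj[OF bij(1)]]) (simp add: inverse map_prod_def split: prod.split)
  qed
  have eq': "(i, j) \<in> poly_verts Q \<longleftrightarrow> (?s i, ?t j) \<in> poly_verts P" for i j
    using eq[of "?s i" "?t j"] by (simp add: inverse)
  have image: "?g ` poly_verts P = poly_verts Q"
  proof (intro equalityI subsetI)
    fix x assume "x \<in> poly_verts Q"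
    then have "map_prod ?s ?t x \<in> poly_verts P" using eq' by (cases x) simp
    moreover have "x = ?g (map_prod ?s ?t x)" by (cases x) (simp add: inverse)
    ultimately show "x \<in> ?g ` poly_verts P" by blast
  qed (auto simp: eq)
  show ?thesis
    unfolding coordinate_ring_eq polyomino_ideal_def
  proof (rule quotient_genideal_iso[OF bij(1) image]; (fold polyomino_ideal_def)?)
    show "rename ?g ` inner_binomials P \<subseteq> (polyomino_ideal Q :: 'k pt_mpoly set)"
      using assms by (rule rename_inner_binomials)
    show "rename (inv_into UNIV ?g) ` inner_binomials Q \<subseteq> (polyomino_ideal P :: 'k pt_mpoly set)"
      unfolding inv_g using assms(2,1) bij(2,3) eq' by (rule rename_inner_binomials)
  qed (intro inner_binomials_carrier assms)+
qed

section \<open>Comparison of the projections\<close>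

lemma vertical_proj_swap: "vertical_proj P = rev (horizontal_proj (prod.swap ` P))"
proof -
  have "box_rows (prod.swap ` P) = box_cols P" by (simp add: box_rows_def box_cols_def)
  moreover have "{c \<in> prod.swap ` P. snd c = i} = prod.swap ` {c \<in> P. fst c = i}" for i by auto
  \<comment> \<open>The reversal arises because columns are listed by increasing and rows by
    decreasing coordinate.\<close>
  ultimately show ?thesis
    by (simp add: vertical_proj_def horizontal_proj_def card_image rev_map)
qed

lemma length_filter_decreasing: "length (filter Q (decreasing xs)) = length (filter Q xs)"
  by (simp add: decreasing_def filter_sort flip: rev_filter)

lemma row_counts_eq:
  assumes "nested_cells P" "nested_cells Q" "0 < t"
    and proj: "\<And>u. length (filter ((\<le>) u) (horizontal_proj P)) = length (filter ((\<le>) u) (horizontal_proj Q))"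
  shows "card {j. t \<le> card (row (poly_verts P) j)} = card {j. t \<le> card (row (poly_verts Q) j)}"
proof -
  have "finite P" "finite Q" using assms(1,2) by (auto simp: nested_cells_def)
  then have "card {q. u \<le> card (row P q)} = card {q. u \<le> card (row Q q)}" if "0 < u" for u
    using that proj by (simp add: card_rows_horizontal_proj)
  from this[of "max 1 (t - 1)"] show ?thesis
    using assms(1-3) by (simp add: card_rows_poly_verts del: max.bounded_iff)
qed

theorem theorem2p1:
  fixes P F :: "point set"
  assumes "L_convex P"
    and "projected_ferrer P F"
  shows "\<exists>\<phi>. graded_algebra_iso
           (coordinate_ring P :: ('k::field, 'k pt_mpoly set) graded_algebra)
           (coordinate_ring F :: ('k, 'k pt_mpoly set) graded_algebra) \<phi>"
proof -
  let ?V = "poly_verts P" and ?W = "poly_verts F"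
  let ?P' = "prod.swap ` P" and ?F' = "prod.swap ` F"
  have nested: "nested_cells P" "nested_cells F"
    using assms L_convex_nested_cells ferrer_diagram_nested_cells by (auto simp: projected_ferrer_def)
  then have nested': "nested_cells ?P'" "nested_cells ?F'" by (simp_all add: nested_cells_swap)
  have fin: "finite ?V" "finite ?W" using nested by (auto simp: nested_cells_def intro: finite_poly_verts)
  have fin': "finite (poly_verts ?P')" "finite (poly_verts ?F')" using fin by (simp_all add: poly_verts_swap)
  have H: "length (filter ((\<le>) u) (horizontal_proj P)) = length (filter ((\<le>) u) (horizontal_proj F))" for u
    using assms(2) by (simp add: projected_ferrer_def length_filter_decreasing)
  have V: "length (filter ((\<le>) u) (horizontal_proj ?P')) = length (filter ((\<le>) u) (horizontal_proj ?F'))" for u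
  proof -
    have "length (filter ((\<le>) u) (vertical_proj P)) = length (filter ((\<le>) u) (vertical_proj F))"
      using assms(2) by (simp add: projected_ferrer_def length_filter_decreasing)
    then show ?thesis by (simp add: vertical_proj_swap flip: rev_filter)
  qed
  note counts = row_counts_eq[OF nested _ H] and counts' = row_counts_eq[OF nested' _ V]
  \<comment> \<open>\<open>t\<close> matches rows of equal length and \<open>s\<close> columns of
    equal length, columns being treated as rows of the swapped sets.\<close>
  obtain t where t: "bij t" "\<And>j. card (row ?W (t j)) = card (row ?V j)"
    using level_preserving_bij[OF finite_rows[OF fin(1)] finite_rows[OF fin(2)] counts] by metis
  obtain s where s: "bij s" "\<And>i. card (row (poly_verts ?F') (s i)) = card (row (poly_verts ?P') i)"
    using level_preserving_bij[OF finite_rows[OF fin'(1)] finite_rows[OF fin'(2)] counts'] by metis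
  have "nested ?V" "nested ?W" using nested by (auto simp: nested_cells_def intro: nested_poly_verts)
  \<comment> \<open>By \<open>mem_iff_card_row\<close>, membership depends only on the length of the
    row, the length of the column and the number of rows at least as long; \<open>t\<close>,
    \<open>s\<close> and \<open>counts\<close> match these three.\<close>
  then have "(i, j) \<in> ?V \<longleftrightarrow> (s i, t j) \<in> ?W" for i j
    using s(2) t(2) counts mem_iff_card_row[of ?V i j] mem_iff_card_row[of ?W "s i" "t j"] fin
    by (auto simp: poly_verts_swap)
  then show ?thesis by (rule coordinate_ring_iso_of_permutation[OF nested s(1) t(1)])
qed

end
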